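(* Let $c_1>0$ and $B>0$ be constants. Let $(S,n)$ range over a sequence of pairs of positive integers with $n/S\to\infty$. For each such pair let $g$ (possibly depending on $S,n$) be a real-valued function on $[0,\infty)^2$ with $g(x,y)\in[-B,B]$ for $(x,y)\in[0,\frac{2c_1\ln n}{n}]^2$, $g(x,y)=|x-y|$ for $(x,y)\notin[0,\frac{2c_1\ln n}{n}]^2$, and $g(0,0)=0$, and let $\hat L=\sum_{i=1}^Sg(\hat p_i,\hat q_i)$. Then $$\frac{n\ln n}{S}\,\sup_{P,Q\in\mathcal{M}_S}\mathbb{E}\big|\hat L-\|P-Q\|_1\big|^2\longrightarrow\infty$$ along the sequence.
   Context: $\mathcal{M}_S$ is the set of probability vectors on $\{1,\dots,S\}$; $\|P-Q\|_1=\sum_{i=1}^S|p_i-q_i|$; logarithms are natural. Poisson sampling model with both $P=(p_i)$ and $Q=(q_i)$ unknown: mutually independent $X_i\sim\mathrm{Poi}(np_i)$, $Y_i\sim\mathrm{Poi}(nq_i)$, $1\le i\le S$, and $\hat p_i=X_i/n$, $\hat q_i=Y_i/n$. *)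

theory Defs
  imports "HOL-Probability.Probability"
begin

definition prob_vectors :: "nat \<Rightarrow> (nat \<Rightarrow> real) set" where
  "prob_vectors S = {p \<in> {1..S} \<rightarrow>\<^sub>E {0..}. (\<Sum>i\<in>{1..S}. p i) = 1}"

definition l1_dist :: "nat \<Rightarrow> (nat \<Rightarrow> real) \<Rightarrow> (nat \<Rightarrow> real) \<Rightarrow> real" where
  "l1_dist S p q = (\<Sum>i\<in>{1..S}. \<bar>p i - q i\<bar>)"

text \<open>The library specifies \<^const>\<open>poisson_pmf\<close> only for positive rates;
  \<open>Poi(0)\<close> is the point mass at \<open>0\<close>.\<close>

definition Poi :: "real \<Rightarrow> nat pmf" where
  "Poi r = (if r = 0 then return_pmf 0 else poisson_pmf r)"

text \<open>Joint law of the \<open>2S\<close> mutually independent counts \<open>(X, Y)\<close>; coordinates outside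
  \<open>{1..S}\<close> are constantly \<open>0\<close> and play no role.\<close>

definition poisson_model ::
    "nat \<Rightarrow> nat \<Rightarrow> (nat \<Rightarrow> real) \<Rightarrow> (nat \<Rightarrow> real) \<Rightarrow> ((nat \<Rightarrow> nat) \<times> (nat \<Rightarrow> nat)) pmf" where
  "poisson_model S n p q =
     pair_pmf (Pi_pmf {1..S} 0 (\<lambda>i. Poi (real n * p i)))
              (Pi_pmf {1..S} 0 (\<lambda>i. Poi (real n * q i)))"

definition L_hat ::
    "nat \<Rightarrow> nat \<Rightarrow> (real \<Rightarrow> real \<Rightarrow> real) \<Rightarrow> (nat \<Rightarrow> nat) \<Rightarrow> (nat \<Rightarrow> nat) \<Rightarrow> real" where
  "L_hat S n g X Y = (\<Sum>i\<in>{1..S}. g (real (X i) / real n) (real (Y i) / real n))"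

text \<open>The expectation of the nonnegative squared error is taken in \<^typ>\<open>ennreal\<close>, so that the
  supremum over \<open>P, Q\<close> is meaningful without a separate boundedness argument.\<close>

definition sq_risk ::
    "nat \<Rightarrow> nat \<Rightarrow> (real \<Rightarrow> real \<Rightarrow> real) \<Rightarrow> (nat \<Rightarrow> real) \<Rightarrow> (nat \<Rightarrow> real) \<Rightarrow> ennreal" where
  "sq_risk S n g p q =
     (\<integral>\<^sup>+ (X, Y). ennreal (\<bar>L_hat S n g X Y - l1_dist S p q\<bar>\<^sup>2) \<partial>measure_pmf (poisson_model S n p q))"

definition low_box :: "real \<Rightarrow> nat \<Rightarrow> (real \<times> real) set" where
  "low_box c n = {0..2 * c * ln (real n) / real n} \<times> {0..2 * c * ln (real n) / real n}"

text \<open>Values of \<open>g\<close> outside the quadrant \<open>[0,\<infinity>)\<^sup>2\<close> are unconstrained.\<close>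

definition admissible :: "real \<Rightarrow> real \<Rightarrow> nat \<Rightarrow> (real \<Rightarrow> real \<Rightarrow> real) \<Rightarrow> bool" where
  "admissible c B n g \<longleftrightarrow>
     (\<forall>x\<ge>0. \<forall>y\<ge>0. (x, y) \<in> low_box c n \<longrightarrow> g x y \<in> {-B..B}) \<and>
     (\<forall>x\<ge>0. \<forall>y\<ge>0. (x, y) \<notin> low_box c n \<longrightarrow> g x y = \<bar>x - y\<bar>) \<and>
     g 0 0 = 0"

end

theory Submission
  imports Defs "HOL-Real_Asymp.Real_Asymp"
begin

text \<open>
  The estimator already fails on the diagonal \<open>P = Q\<close>, where the target is \<open>0\<close>.
  Let \<open>P = Q\<close> be uniform on \<open>m\<close> symbols, with \<open>m\<close> as large as possible subject to \<open>m \<le> S\<close> and to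
  the rate \<open>r = n / m\<close> being at least \<open>(4 c\<^sub>1 + 4) ln n\<close>. At such a rate an empirical pair falls in
  the box where \<open>g\<close> is free only with probability at most \<open>n\<^sup>-\<^sup>2\<close>, so on every active
  symbol \<open>g\<close> is essentially \<open>\<bar>X - Y\<bar> / n\<close>, whose mean is of order \<open>\<surd>r / n\<close>, whereas the idle
  symbols contribute \<open>g 0 0 = 0\<close>. The bias is therefore of order \<open>m \<surd>r / n = \<surd>(m / n)\<close>, and the
  risk is at least of order \<open>m / n\<close> (lemma \<open>sup_sq_risk_ge\<close>). After multiplication by
  \<open>n ln n / S\<close> this is \<open>(m / S) ln n\<close>: it equals \<open>ln n\<close> when \<open>m = S\<close>, and otherwise
  \<open>m\<close> is of order \<open>n / ln n\<close> and the product is of order \<open>n / S\<close>. Both diverge.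

  Both facts about Poisson counts come from the one generating function identity
  \<open>E z\<^sup>X = exp (r (z - 1))\<close> for \<open>\<bar>z\<bar> \<le> 1\<close>. The tail bound uses \<open>z = 1/2\<close>. For the mean of
  \<open>\<bar>X - Y\<bar>\<close>, the inequality \<open>\<bar>d\<bar> \<ge> (1 - cos (t d)) / t\<close> with \<open>t = 1 / \<surd>r\<close>, which is the
  scale of the fluctuations, reduces it to \<open>z = e\<^sup>i\<^sup>t\<close>. These bounds replace the
  estimator by the bounded function \<open>minorant\<close> of each pair of counts, so that all expectations exist.
\<close>

section \<open>The generating function of the Poisson distribution\<close>

lemma expectation_power_poisson:
  fixes z :: "'a :: {real_normed_field, banach, second_countable_topology}"
  assumes "0 < r" "norm z \<le> 1"
  shows "measure_pmf.expectation (poisson_pmf r) (\<lambda>k. z ^ k) = exp (of_real r * (z - 1))"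
proof -
  have int: "integrable (measure_pmf (poisson_pmf r)) (\<lambda>k. z ^ k)"
    using assms by (intro measure_pmf.integrable_const_bound[where B = 1])
      (auto simp: norm_power power_le_one)
  have eq: "pmf (poisson_pmf r) k *\<^sub>R z ^ k = exp (- r) *\<^sub>R ((of_real r * z) ^ k /\<^sub>R fact k)" for k
    using assms by (simp add: scaleR_conv_of_real power_mult_distrib divide_inverse)
  have "integrable (count_space UNIV) (\<lambda>k. pmf (poisson_pmf r) k *\<^sub>R z ^ k)"
    using int unfolding measure_pmf_eq_density
    by (subst (asm) integrable_density) (auto)
  then have "(\<lambda>k. pmf (poisson_pmf r) k *\<^sub>R z ^ k) sums
      measure_pmf.expectation (poisson_pmf r) (\<lambda>k. z ^ k)"
    using sums_integral_count_space_nat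
    by (simp add: measure_pmf_eq_density integral_density del: pmf_poisson)
  moreover have "(\<lambda>k. pmf (poisson_pmf r) k *\<^sub>R z ^ k) sums (exp (- r) *\<^sub>R exp (of_real r * z))"
    unfolding eq by (intro sums_scaleR_right exp_converges)
  ultimately have "measure_pmf.expectation (poisson_pmf r) (\<lambda>k. z ^ k)
      = exp (- r) *\<^sub>R exp (of_real r * z)"
    by (rule sums_unique2)
  also have "\<dots> = exp (of_real r * (z - 1))"
    by (simp add: scaleR_conv_of_real exp_of_real[symmetric] exp_add[symmetric] algebra_simps
       del: exp_of_real)
  finally show ?thesis .
qed

section \<open>Bounded functions under discrete distributions\<close>

lemma integrable_pmf_bounded:
  fixes f :: "'a \<Rightarrow> real"
  assumes "\<And>x. \<bar>f x\<bar> \<le> K"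
  shows "integrable (measure_pmf M) f"
  using assms by (intro measure_pmf.integrable_const_bound[where B = K]) auto

text \<open>Fubini's theorem; nonnegativity lets it be read off from the iterated \<^typ>\<open>ennreal\<close> integral.\<close>

lemma expectation_pair_pmf_bounded_nonneg:
  fixes f :: "'a \<Rightarrow> 'b \<Rightarrow> real"
  assumes nonneg: "\<And>x y. 0 \<le> f x y" and bound: "\<And>x y. f x y \<le> K"
  shows "measure_pmf.expectation (pair_pmf p q) (\<lambda>(x, y). f x y) =
    measure_pmf.expectation p (\<lambda>x. measure_pmf.expectation q (f x))"
proof -
  have int_f: "integrable (measure_pmf q) (f x)" for x
    using assms by (intro integrable_pmf_bounded[where K = K]) auto
  have inner_nonneg: "0 \<le> measure_pmf.expectation q (f x)" for x
    using nonneg by (intro integral_nonneg_AE) auto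
  have inner_bound: "measure_pmf.expectation q (f x) \<le> K" for x
    using bound int_f by (intro measure_pmf.integral_le_const) auto
  have "ennreal (measure_pmf.expectation (pair_pmf p q) (\<lambda>(x, y). f x y))
      = (\<integral>\<^sup>+ xy. ennreal (case xy of (x, y) \<Rightarrow> f x y) \<partial>pair_pmf p q)"
    using assms by (intro nn_integral_eq_integral[symmetric] integrable_pmf_bounded[where K = K]) auto
  also have "\<dots> = (\<integral>\<^sup>+ x. \<integral>\<^sup>+ y. ennreal (f x y) \<partial>q \<partial>p)"
    by (simp add: nn_integral_pair_pmf')
  also have "\<dots> = (\<integral>\<^sup>+ x. ennreal (measure_pmf.expectation q (f x)) \<partial>p)"
    using nonneg int_f by (intro nn_integral_cong nn_integral_eq_integral) auto
  also have "\<dots> = ennreal (measure_pmf.expectation p (\<lambda>x. measure_pmf.expectation q (f x)))"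
    using inner_nonneg inner_bound
    by (intro nn_integral_eq_integral integrable_pmf_bounded[where K = K]) auto
  finally show ?thesis
    using inner_nonneg nonneg by (subst (asm) ennreal_inj) (auto intro!: integral_nonneg_AE)
qed

text \<open>Jensen's inequality \<open>(E L)\<^sup>2 \<le> E L\<^sup>2\<close> for an \<open>L\<close> that may fail to be integrable: the tangent
  inequality \<open>L\<^sup>2 \<ge> 2 v L - v\<^sup>2\<close> is monotone in \<open>L\<close> because \<open>v \<ge> 0\<close>, so \<open>L\<close> may be replaced by
  \<open>W\<close> before integrating.\<close>

lemma nn_integral_square_ge_of_minorant:
  fixes M :: "'a pmf" and W L :: "'a \<Rightarrow> real"
  assumes int: "integrable (measure_pmf M) W" and "0 \<le> v" "v \<le> measure_pmf.expectation M W"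
    and WL: "\<And>x. x \<in> set_pmf M \<Longrightarrow> W x \<le> L x"
  shows "ennreal (v\<^sup>2) \<le> (\<integral>\<^sup>+ x. ennreal (\<bar>L x\<bar>\<^sup>2) \<partial>M)"
proof -
  have pos: "integrable (measure_pmf M) (\<lambda>x. max 0 (2 * v * W x - v\<^sup>2))"
    using int by auto
  have "v\<^sup>2 \<le> 2 * v * measure_pmf.expectation M W - v\<^sup>2"
    using assms mult_left_mono[of v "measure_pmf.expectation M W" v] by (simp add: power2_eq_square)
  also have "\<dots> = measure_pmf.expectation M (\<lambda>x. 2 * v * W x - v\<^sup>2)"
    using int by simp
  also have "\<dots> \<le> measure_pmf.expectation M (\<lambda>x. max 0 (2 * v * W x - v\<^sup>2))"
    using int pos by (intro integral_mono) auto
  finally have "ennreal (v\<^sup>2) \<le> ennreal (measure_pmf.expectation M (\<lambda>x. max 0 (2 * v * W x - v\<^sup>2)))"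
    by (rule ennreal_leI)
  also have "\<dots> = (\<integral>\<^sup>+ x. ennreal (max 0 (2 * v * W x - v\<^sup>2)) \<partial>M)"
    using pos by (intro nn_integral_eq_integral[symmetric]) auto
  also have "\<dots> \<le> (\<integral>\<^sup>+ x. ennreal (\<bar>L x\<bar>\<^sup>2) \<partial>M)"
  proof (intro nn_integral_mono_AE, subst AE_measure_pmf_iff, intro ballI ennreal_leI)
    fix x assume "x \<in> set_pmf M"
    then have "2 * v * W x - v\<^sup>2 \<le> 2 * v * L x - v\<^sup>2"
      using WL[of x] \<open>0 \<le> v\<close> by (simp add: mult_left_mono)
    also have "\<dots> \<le> (L x)\<^sup>2"
      using zero_le_power2[of "L x - v"] by (simp add: power2_diff algebra_simps)
    finally show "max 0 (2 * v * W x - v\<^sup>2) \<le> \<bar>L x\<bar>\<^sup>2"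
      by simp
  qed
  finally show ?thesis .
qed

section \<open>Fluctuation and tail of Poisson counts\<close>

lemma one_minus_cos_le_abs: "1 - cos u \<le> \<bar>u\<bar>" for u :: real
proof -
  have "1 - cos u = 2 * (\<bar>sin (u / 2)\<bar> * \<bar>sin (u / 2)\<bar>)"
    using cos_double_sin[of "u / 2"] by (simp add: power2_eq_square)
  also have "\<dots> \<le> 2 * (\<bar>u / 2\<bar> * 1)"
    by (intro mult_left_mono mult_mono abs_sin_x_le_abs_x) auto
  finally show ?thesis by simp
qed

text \<open>The constant \<open>1/4\<close> in place of \<open>1/2\<close>, its limit at \<open>0\<close>, leaves room for the cubic Taylor remainder
  of the sine in \<open>1 - cos t = 2 sin\<^sup>2 (t / 2)\<close>.\<close>

lemma one_minus_cos_ge_quarter_square: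
  fixes t :: real
  assumes "0 \<le> t" "t \<le> 1"
  shows "t\<^sup>2 / 4 \<le> 1 - cos t"
proof -
  have "\<bar>sin (t / 2) - t / 2\<bar> \<le> (t / 2) ^ 3 / 6"
    using Maclaurin_sin_bound[of "t / 2" 3] assms
    by (simp add: eval_nat_numeral sin_coeff_def field_simps)
  moreover have "(t / 2) ^ 3 \<le> t / 2"
    using assms power_decreasing[of 1 3 "t / 2"] by simp
  ultimately have "3 / 4 * (t / 2) \<le> sin (t / 2)"
    using assms by linarith
  then have "(3 / 4 * (t / 2))\<^sup>2 \<le> (sin (t / 2))\<^sup>2"
    using assms by (intro power_mono) auto
  moreover have "1 - cos t = 2 * (sin (t / 2))\<^sup>2"
    using cos_double_sin[of "t / 2"] by simp
  moreover have "(3 / 4 * (t / 2))\<^sup>2 = 9 / 64 * t\<^sup>2"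
    by (simp add: power_mult_distrib power_divide)
  ultimately show ?thesis
    using zero_le_power2[of "sin (t / 2)"] by linarith
qed

text \<open>The characteristic function of \<open>X - Y\<close> is \<open>\<bar>E e\<^sup>i\<^sup>t\<^sup>X\<bar>\<^sup>2\<close>, which is real.\<close>

lemma expectation_one_minus_cos_poisson_difference:
  fixes t :: real
  assumes "0 < r"
  shows "measure_pmf.expectation (pair_pmf (poisson_pmf r) (poisson_pmf r))
      (\<lambda>(x, y). 1 - cos (t * (real x - real y))) = 1 - exp (- 2 * r * (1 - cos t))"
proof -
  let ?E = "measure_pmf.expectation (poisson_pmf r)"
  define \<phi> where "\<phi> = exp (of_real r * (cis t - 1))"
  have \<phi>: "?E (\<lambda>k. cis t ^ k) = \<phi>"
    unfolding \<phi>_def using assms by (intro expectation_power_poisson) auto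
  have int: "integrable (measure_pmf (poisson_pmf r)) (\<lambda>k. cis t ^ k)"
    by (intro measure_pmf.integrable_const_bound[where B = 1]) (auto simp: norm_power)
  have E_cos: "?E (\<lambda>k. cos (t * real k)) = Re \<phi>" and E_sin: "?E (\<lambda>k. sin (t * real k)) = Im \<phi>"
    using integral_Re[OF int] integral_Im[OF int] \<phi>
    by (simp_all add: Complex.DeMoivre mult.commute)
  have int_cos: "integrable (measure_pmf (poisson_pmf r)) (\<lambda>k. cos (t * real k))"
    and int_sin: "integrable (measure_pmf (poisson_pmf r)) (\<lambda>k. sin (t * real k))"
    by (auto intro!: integrable_pmf_bounded[where K = 1])
  have "measure_pmf.expectation (pair_pmf (poisson_pmf r) (poisson_pmf r))
      (\<lambda>(x, y). 1 - cos (t * (real x - real y)))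
      = ?E (\<lambda>x. ?E (\<lambda>y. 1 - cos (t * (real x - real y))))"
  proof (intro expectation_pair_pmf_bounded_nonneg[where K = 2])
    show "1 - cos (t * (real x - real y)) \<le> 2" for x y
      using cos_ge_minus_one[of "t * (real x - real y)"] by linarith
  qed simp
  also have "(\<lambda>x. ?E (\<lambda>y. 1 - cos (t * (real x - real y))))
      = (\<lambda>x. 1 - (Re \<phi> * cos (t * real x) + Im \<phi> * sin (t * real x)))"
    using int_cos int_sin
    by (simp add: right_diff_distrib cos_diff E_cos E_sin mult.commute fun_eq_iff)
  also have "?E \<dots> = 1 - ((Re \<phi>)\<^sup>2 + (Im \<phi>)\<^sup>2)"
    using int_cos int_sin by (simp add: E_cos E_sin power2_eq_square)
  also have "(Re \<phi>)\<^sup>2 + (Im \<phi>)\<^sup>2 = (norm \<phi>)\<^sup>2"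
    by (simp add: cmod_power2)
  also have "norm \<phi> = exp (r * (cos t - 1))"
    by (simp add: \<phi>_def norm_exp_eq_Re)
  also have "\<dots>\<^sup>2 = exp (- 2 * r * (1 - cos t))"
    by (simp add: exp_double[symmetric] algebra_simps)
  finally show ?thesis .
qed

text \<open>Markov's inequality for \<open>2\<^sup>-\<^sup>X\<close>; the base \<open>2\<close> is not optimised, since the rate will exceed \<open>a\<close>
  by a sufficient constant factor.\<close>

lemma prob_poisson_le_Chernoff:
  assumes "0 < r"
  shows "measure_pmf.prob (poisson_pmf r) {k. real k \<le> a} \<le> 2 powr a * exp (- r / 2)"
proof -
  have "measure_pmf.prob (poisson_pmf r) {k. real k \<le> a}
      = measure_pmf.expectation (poisson_pmf r) (indicator {k. real k \<le> a})"
    by simp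
  also have "\<dots> \<le> measure_pmf.expectation (poisson_pmf r) (\<lambda>k. 2 powr a * (1 / 2) ^ k)"
  proof (rule integral_mono_AE)
    show "integrable (measure_pmf (poisson_pmf r)) (\<lambda>k. 2 powr a * (1 / 2) ^ k)"
      by (auto intro!: integrable_pmf_bounded[where K = "2 powr a"] simp: abs_mult power_le_one field_simps)
    have "indicator {k. real k \<le> a} k \<le> 2 powr a * (1 / 2 :: real) ^ k" for k
    proof -
      have "2 powr real k \<le> 2 powr a" if "real k \<le> a"
        using that by simp
      then show ?thesis
        by (auto simp: indicator_def powr_realpow field_simps)
    qed
    then show "AE k in measure_pmf (poisson_pmf r).
        indicator {k. real k \<le> a} k \<le> 2 powr a * (1 / 2 :: real) ^ k"
      by simp
  qed (auto intro!: integrable_pmf_bounded[where K = 1])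
  also have "\<dots> = 2 powr a * exp (- r / 2)"
    using expectation_power_poisson[of r "1 / 2 :: real"] assms by simp
  finally show ?thesis .
qed

section \<open>A bounded minorant of the admissible functions\<close>

text \<open>The first term minorises \<open>\<bar>x - y\<bar> / n\<close>. The second pays for the box, and is charged as soon as
  the first count alone is small, which needs only a one-dimensional tail bound.\<close>

definition minorant :: "real \<Rightarrow> real \<Rightarrow> real \<Rightarrow> nat \<Rightarrow> nat \<Rightarrow> nat \<Rightarrow> real" where
  "minorant c K r n x y = sqrt r / real n * (1 - cos (1 / sqrt r * (real x - real y)))
     - K * indicator {k. real k \<le> 2 * c * ln (real n)} x"

lemma abs_minorant_le:
  assumes "0 \<le> r" "0 \<le> K"
  shows "\<bar>minorant c K r n x y\<bar> \<le> 2 * sqrt r / real n + K"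
proof -
  define D where "D = sqrt r / real n * (1 - cos (1 / sqrt r * (real x - real y)))"
  have "D \<le> sqrt r / real n * 2"
    using assms cos_ge_minus_one[of "1 / sqrt r * (real x - real y)"]
    unfolding D_def by (intro mult_left_mono) auto
  then have "D \<le> 2 * sqrt r / real n"
    by (simp add: mult.commute)
  moreover have "0 \<le> D"
    using assms by (simp add: D_def)
  ultimately show ?thesis
    using assms unfolding minorant_def D_def[symmetric] by (simp add: indicator_def) linarith
qed

text \<open>Inside the box the cosine term is at most \<open>\<bar>x - y\<bar> / n \<le> 2 c ln n / n \<le> 2 c\<close>, so the penalty
  \<open>B + 2 c\<close> brings the minorant below \<open>- B\<close>, hence below \<open>g\<close>.\<close>

lemma minorant_le_admissible:
  assumes adm: "admissible c B n g" and "0 < r" "0 < n" "0 \<le> c" "0 \<le> B"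
  shows "minorant c (B + 2 * c) r n x y \<le> g (real x / real n) (real y / real n)"
proof -
  define D where "D = sqrt r / real n * (1 - cos (1 / sqrt r * (real x - real y)))"
  have "D \<le> sqrt r / real n * \<bar>1 / sqrt r * (real x - real y)\<bar>"
    unfolding D_def using assms by (intro mult_left_mono one_minus_cos_le_abs) auto
  also have "\<dots> = \<bar>real x - real y\<bar> / real n"
    using assms by (simp add: abs_mult)
  finally have D: "D \<le> \<bar>real x - real y\<bar> / real n" .
  show ?thesis
  proof (cases "(real x / real n, real y / real n) \<in> low_box c n")
    case True
    then have "g (real x / real n) (real y / real n) \<ge> - B"
      using adm by (auto simp: admissible_def)
    moreover have x: "real x \<le> 2 * c * ln (real n)" and y: "real y \<le> 2 * c * ln (real n)"
      using True assms by (auto simp: low_box_def field_simps)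
    moreover have "D \<le> 2 * c"
    proof -
      have "\<bar>real x - real y\<bar> \<le> 2 * c * ln (real n)"
        using x y by linarith
      also have "\<dots> \<le> 2 * c * real n"
        using assms ln_bound[of "real n"] by (intro mult_left_mono) auto
      finally show ?thesis
        using D assms by (simp add: divide_le_eq order_trans[OF D])
    qed
    ultimately show ?thesis
      by (simp add: minorant_def D_def)
  next
    case False
    then have "g (real x / real n) (real y / real n) = \<bar>real x / real n - real y / real n\<bar>"
      using adm by (auto simp: admissible_def)
    also have "\<dots> = \<bar>real x - real y\<bar> / real n"
      by (simp add: diff_divide_distrib[symmetric])
    finally show ?thesis
      using D assms unfolding minorant_def D_def[symmetric] by (auto simp: indicator_def)
  qed
qed

text \<open>At the scale \<open>t = 1 / \<surd>r\<close> the exponent \<open>2 r (1 - cos t)\<close> is at least \<open>1/2\<close>, so the mean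
  fluctuation is a constant. In the tail, \<open>2\<^sup>a \<le> e\<^sup>a\<close> with \<open>a = 2 c ln n\<close> costs a factor \<open>n\<^sup>2\<^sup>c\<close>;
  half of the rate \<open>(4 c + 4) ln n\<close> absorbs it and leaves \<open>n\<^sup>-\<^sup>2\<close>.\<close>

lemma expectation_minorant_ge:
  assumes "1 \<le> r" "(4 * c + 4) * ln (real n) \<le> r" "0 < n" "0 \<le> K" "0 \<le> c"
  shows "sqrt r / (4 * real n) - K / (real n)\<^sup>2 \<le>
    measure_pmf.expectation (pair_pmf (poisson_pmf r) (poisson_pmf r))
      (\<lambda>(x, y). minorant c K r n x y)"
proof -
  let ?E = "measure_pmf.expectation (pair_pmf (poisson_pmf r) (poisson_pmf r))"
  let ?D = "\<lambda>xy. 1 - cos (1 / sqrt r * (real (fst xy) - real (snd xy)))"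
  let ?I = "\<lambda>xy. indicator {k. real k \<le> 2 * c * ln (real n)} (fst xy)"
  have fluct: "1 / 4 \<le> ?E ?D"
  proof -
    have "(1 / sqrt r)\<^sup>2 / 4 \<le> 1 - cos (1 / sqrt r)"
      using assms by (intro one_minus_cos_ge_quarter_square) auto
    then have "1 / 2 \<le> 2 * r * (1 - cos (1 / sqrt r))"
      using assms by (simp add: power_divide field_simps)
    then have "exp (- 2 * r * (1 - cos (1 / sqrt r))) \<le> exp (- (1 / 2))"
      by simp
    also have "\<dots> \<le> 3 / 4"
      using exp_ge_add_one_self[of "1 / 2"] by (simp add: exp_minus field_simps)
    finally show ?thesis
      using expectation_one_minus_cos_poisson_difference[of r "1 / sqrt r"] assms
      by (simp add: case_prod_unfold)
  qed
  have tail: "?E ?I \<le> 1 / (real n)\<^sup>2"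
  proof -
    have ln: "0 \<le> ln (real n)" using assms by simp
    have "?E ?I = measure_pmf.prob (poisson_pmf r) {k. real k \<le> 2 * c * ln (real n)}"
      by simp
    also have "\<dots> \<le> 2 powr (2 * c * ln (real n)) * exp (- r / 2)"
      using assms by (intro prob_poisson_le_Chernoff) auto
    also have "2 powr (2 * c * ln (real n)) \<le> exp (2 * c * ln (real n))"
      using assms ln ln_2_less_1 mult_right_le_one_le[of "2 * c * ln (real n)" "ln 2"]
      by (simp add: powr_def)
    also have "exp (2 * c * ln (real n)) * exp (- r / 2) \<le> exp (- (2 * ln (real n)))"
      using assms by (simp add: exp_add[symmetric] algebra_simps)
    also have "\<dots> = 1 / (real n)\<^sup>2"
      using assms by (simp add: exp_minus exp_double divide_inverse)
    finally show ?thesis by simp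
  qed
  have int_D: "integrable (pair_pmf (poisson_pmf r) (poisson_pmf r)) ?D"
    by (rule integrable_pmf_bounded[where K = 2])
      (use cos_ge_minus_one in \<open>auto simp: abs_le_iff intro: order_trans\<close>)
  have int_I: "integrable (pair_pmf (poisson_pmf r) (poisson_pmf r)) (\<lambda>xy. ?I xy :: real)"
    by (rule integrable_pmf_bounded[where K = 1]) (auto simp: indicator_def)
  have "sqrt r / (4 * real n) - K / (real n)\<^sup>2
      = sqrt r / real n * (1 / 4) - K * (1 / (real n)\<^sup>2)"
    by simp
  also have "\<dots> \<le> sqrt r / real n * ?E ?D - K * ?E ?I"
    using assms fluct tail by (intro diff_mono mult_left_mono) auto
  also have "\<dots> = ?E (\<lambda>xy. sqrt r / real n * ?D xy - K * ?I xy)"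
    using int_D int_I by simp
  finally show ?thesis
    by (simp add: minorant_def case_prod_unfold)
qed

section \<open>The risk at a uniform distribution\<close>

text \<open>The witness is \<open>P = Q\<close> uniform on \<open>{1..m}\<close>. In terms of \<open>s = \<surd>(m / n)\<close> the bias accumulated
  over the active symbols is at least \<open>s / 4 - s\<^sup>2 K / n\<close>; the correction is at most \<open>s / 8\<close>
  because \<open>s \<le> 1\<close> and \<open>n \<ge> 8 K\<close>. The bias thus is at least \<open>s / 8\<close>, whose square is \<open>m / (64 n)\<close>.\<close>

lemma sup_sq_risk_ge:
  assumes adm: "admissible c B n g" and c: "0 < c" and B: "0 < B"
    and m: "0 < m" "m \<le> S" "m \<le> n" "real m * ((4 * c + 4) * ln (real n)) \<le> real n"
    and n: "8 * (B + 2 * c) \<le> real n"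
  shows "ennreal (real m / (64 * real n)) \<le>
    (SUP (P, Q) \<in> prob_vectors S \<times> prob_vectors S. sq_risk S n g P Q)"
proof -
  define p where "p = restrict (\<lambda>i. if i \<le> m then 1 / real m else 0) {1..S}"
  define r where "r = real n / real m"
  define K where "K = B + 2 * c"
  define s where "s = sqrt (real m / real n)"
  define W where "W = (\<lambda>(X, Y). \<Sum>i\<in>{1..m}. minorant c K r n (X i) (Y i))"
  have npos: "0 < n" using m by simp
  have sub: "{1..m} \<subseteq> {1..S}" using m by auto
  have r: "1 \<le> r" "(4 * c + 4) * ln (real n) \<le> r"
    using m by (auto simp: r_def field_simps)
  have s: "0 < s" "s \<le> 1" "s\<^sup>2 = real m / real n"
    using m by (auto simp: s_def)
  have sqrt_r: "sqrt r = 1 / s"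
    by (simp add: r_def s_def real_sqrt_divide)
  have "(\<Sum>i\<in>{1..S}. p i) = (\<Sum>i\<in>{1..m}. 1 / real m)"
    using sub by (intro sum.mono_neutral_cong_right) (auto simp: p_def)
  then have p_mem: "p \<in> prob_vectors S"
    using m by (auto simp: prob_vectors_def p_def)
  have rate: "Poi (real n * p i) = poisson_pmf r" if "i \<in> {1..m}" for i
    using that sub npos m by (auto simp: p_def r_def Poi_def)
  \<comment> \<open>Under rate 0 the counts vanish almost surely, so there the estimator picks up \<open>g 0 0 = 0\<close>.\<close>
  have idle: "Poi (real n * p i) = return_pmf 0" if "i \<in> {1..S} - {1..m}" for i
    using that by (auto simp: p_def Poi_def)
  let ?M = "poisson_model S n p p"
  have marginal: "map_pmf (\<lambda>(X, Y). (X i, Y i)) ?M = pair_pmf (poisson_pmf r) (poisson_pmf r)"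
    if "i \<in> {1..m}" for i
    using that sub rate[OF that]
    by (auto simp: poisson_model_def map_pair Pi_pmf_component)
  have bounded: "\<bar>minorant c K r n x y\<bar> \<le> 2 * sqrt r / real n + K" for x y
    using r c B by (intro abs_minorant_le) (auto simp: K_def)
  have int: "integrable ?M (\<lambda>(X, Y). minorant c K r n (X i) (Y i))" for i
    using bounded by (intro integrable_pmf_bounded) auto
  have "measure_pmf.expectation ?M (\<lambda>(X, Y). minorant c K r n (X i) (Y i))
      = measure_pmf.expectation (pair_pmf (poisson_pmf r) (poisson_pmf r))
          (\<lambda>(x, y). minorant c K r n x y)" if "i \<in> {1..m}" for i
    unfolding marginal[OF that, symmetric] by (simp add: case_prod_unfold)
  then have coordinate: "1 / (4 * s * real n) - K / (real n)\<^sup>2 \<le>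
      measure_pmf.expectation ?M (\<lambda>(X, Y). minorant c K r n (X i) (Y i))" if "i \<in> {1..m}" for i
    using expectation_minorant_ge[OF r npos, of K] c B that by (simp add: sqrt_r K_def)
  have "s / 8 \<le> measure_pmf.expectation ?M W"
  proof -
    have "K / real n \<le> 1 / 8"
      using n npos by (simp add: K_def field_simps)
    moreover have "s\<^sup>2 \<le> s"
      using s(1,2) by (simp add: power2_eq_square mult_left_le)
    ultimately have correction: "s\<^sup>2 * (K / real n) \<le> s * (1 / 8)"
      using s(1) B c by (intro mult_mono) (auto simp: K_def)
    have total: "s / 4 - s\<^sup>2 * (K / real n) = real m * (1 / (4 * s * real n) - K / (real n)\<^sup>2)"
    proof -
      have "real m * (1 / (4 * s * real n)) = s\<^sup>2 / (4 * s)"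
        using s by simp
      also have "\<dots> = s / 4"
        using s(1) by (simp add: power2_eq_square)
      finally have main: "real m * (1 / (4 * s * real n)) = s / 4" .
      have rest: "real m * (K / (real n)\<^sup>2) = s\<^sup>2 * (K / real n)"
        unfolding s(3) by (simp add: power2_eq_square)
      show ?thesis
        unfolding right_diff_distrib[of "real m"] main rest by (rule refl)
    qed
    have "s / 8 = s / 4 - s * (1 / 8)"
      by simp
    also have "\<dots> \<le> s / 4 - s\<^sup>2 * (K / real n)"
      by (intro diff_left_mono correction)
    also have "\<dots> = real m * (1 / (4 * s * real n) - K / (real n)\<^sup>2)"
      by (rule total)
    also have "\<dots> = (\<Sum>i\<in>{1..m}. 1 / (4 * s * real n) - K / (real n)\<^sup>2)"
      by simp
    also have "\<dots> \<le> (\<Sum>i\<in>{1..m}. measure_pmf.expectation ?M (\<lambda>(X, Y). minorant c K r n (X i) (Y i)))"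
      by (intro sum_mono coordinate)
    also have "\<dots> = measure_pmf.expectation ?M W"
      using int unfolding W_def by (simp add: case_prod_unfold)
    finally show ?thesis .
  qed
  moreover have "integrable ?M W"
    using int unfolding W_def by (simp add: case_prod_unfold)
  moreover have "W XY \<le> (case XY of (X, Y) \<Rightarrow> L_hat S n g X Y - l1_dist S p p)"
    if "XY \<in> set_pmf ?M" for XY
  proof -
    obtain X Y where XY: "XY = (X, Y)" by force
    have support: "X i \<in> set_pmf (Poi (real n * p i))" "Y i \<in> set_pmf (Poi (real n * p i))"
      if "i \<in> {1..S}" for i
      using \<open>XY \<in> set_pmf ?M\<close> that
      unfolding XY poisson_model_def set_pair_pmf set_Pi_pmf[OF finite_atLeastAtMost] PiE_dflt_def
        mem_Sigma_iff mem_Collect_eq comp_def by blast+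
    have zero: "X i = 0" "Y i = 0" if "i \<in> {1..S} - {1..m}" for i
      using support[of i] that unfolding idle[OF that] by simp_all
    have "g 0 0 = 0"
      using adm unfolding admissible_def by blast
    then have "L_hat S n g X Y = (\<Sum>i\<in>{1..m}. g (real (X i) / real n) (real (Y i) / real n))"
      unfolding L_hat_def using sub
      by (intro sum.mono_neutral_right ballI) (simp_all only: finite_atLeastAtMost zero of_nat_0 div_0)
    moreover have "W (X, Y) \<le> \<dots>"
      unfolding W_def prod.case K_def using r npos c B
      by (intro sum_mono minorant_le_admissible[OF adm]) linarith+
    moreover have "l1_dist S p p = 0"
      by (simp add: l1_dist_def)
    ultimately show ?thesis
      unfolding XY prod.case by linarith
  qed
  ultimately have "ennreal ((s / 8)\<^sup>2) \<le>
      (\<integral>\<^sup>+ XY. ennreal (\<bar>case XY of (X, Y) \<Rightarrow> L_hat S n g X Y - l1_dist S p p\<bar>\<^sup>2) \<partial>?M)"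
    using s by (intro nn_integral_square_ge_of_minorant) auto
  also have "\<dots> = sq_risk S n g p p"
    by (simp add: sq_risk_def case_prod_unfold)
  also have "\<dots> \<le> (SUP (P, Q) \<in> prob_vectors S \<times> prob_vectors S. sq_risk S n g P Q)"
    using p_mem by (intro SUP_upper2[of "(p, p)"]) auto
  also have "(s / 8)\<^sup>2 = real m / (64 * real n)"
    using s by (simp add: power_divide)
  finally show ?thesis .
qed

section \<open>Divergence of the normalised risk\<close>

theorem lemma5:
  fixes c\<^sub>1 B :: real
    and S n :: "nat \<Rightarrow> nat"
    and g :: "nat \<Rightarrow> real \<Rightarrow> real \<Rightarrow> real"
  assumes "c\<^sub>1 > 0" and "B > 0"
    and "\<And>k. S k > 0" and "\<And>k. n k > 0"
    and "filterlim (\<lambda>k. real (n k) / real (S k)) at_top sequentially"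
    and "\<And>k. admissible c\<^sub>1 B (n k) (g k)"
  shows "(\<lambda>k. ennreal (real (n k) * ln (real (n k)) / real (S k)) *
           (SUP (P, Q) \<in> prob_vectors (S k) \<times> prob_vectors (S k). sq_risk (S k) (n k) (g k) P Q))
         \<longlonglongrightarrow> \<infinity>"
proof -
  define C where "C = 4 * c\<^sub>1 + 4"
  define h where "h = (\<lambda>k. min (1 / 64 * ln (real (n k))) (1 / (128 * C) * (real (n k) / real (S k))))"
  have C: "4 < C" using assms by (simp add: C_def)
  have "real (n k) / real (S k) \<le> real (n k)" for k
    using assms(3)[of k] by (simp add: divide_le_eq mult_le_cancel_left1)
  then have n_top: "filterlim (\<lambda>k. real (n k)) at_top sequentially"
    by (intro filterlim_at_top_mono[OF assms(5)]) auto
  have "filterlim (\<lambda>k. 1 / 64 * ln (real (n k))) at_top sequentially"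
    by (rule filterlim_tendsto_pos_mult_at_top[OF tendsto_const])
      (auto intro: filterlim_compose[OF ln_at_top n_top])
  moreover have "filterlim (\<lambda>k. 1 / (128 * C) * (real (n k) / real (S k))) at_top sequentially"
    by (rule filterlim_tendsto_pos_mult_at_top[OF tendsto_const _ assms(5)]) (use C in auto)
  ultimately have h_top: "filterlim h at_top sequentially"
    unfolding h_def filterlim_at_top by (auto intro: eventually_conj elim: eventually_elim2)
  have "eventually (\<lambda>x::real. 8 * (B + 2 * c\<^sub>1) \<le> x \<and> 1 \<le> ln x \<and> C * ln x \<le> x) at_top"
    using C by (intro eventually_conj; real_asymp)
  with n_top have ev: "eventually (\<lambda>k. 8 * (B + 2 * c\<^sub>1) \<le> real (n k) \<and> 1 \<le> ln (real (n k))
      \<and> C * ln (real (n k)) \<le> real (n k)) sequentially"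
    by (rule eventually_compose_filterlim[rotated])
  have lower: "eventually (\<lambda>k. ennreal (h k) \<le> ennreal (real (n k) * ln (real (n k)) / real (S k)) *
           (SUP (P, Q) \<in> prob_vectors (S k) \<times> prob_vectors (S k). sq_risk (S k) (n k) (g k) P Q))
         sequentially"
    using ev
  proof eventually_elim
    case (elim k)
    let ?n = "n k" and ?S = "S k"
    \<comment> \<open>\<open>x\<close> is the real number of symbols at which the rate is exactly \<open>C ln n\<close>; as \<open>x \<ge> 1\<close>,
      rounding down loses at most a factor 2.\<close>
    define x where "x = real ?n / (C * ln (real ?n))"
    define m where "m = min ?S (nat \<lfloor>x\<rfloor>)"
    have Cln: "1 \<le> C * ln (real ?n)"
      using elim C mult_mono[of 1 C 1 "ln (real ?n)"] by simp
    have x: "1 \<le> x" "x \<le> real ?n" "x * (C * ln (real ?n)) = real ?n"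
      using elim Cln C by (auto simp: x_def field_simps)
    have floor_eq: "real (nat \<lfloor>x\<rfloor>) = real_of_int \<lfloor>x\<rfloor>"
      using x(1) by simp
    have "1 \<le> real_of_int \<lfloor>x\<rfloor>"
      using x(1) by simp
    then have floor_ge: "x / 2 \<le> real (nat \<lfloor>x\<rfloor>)"
      using real_of_int_floor_add_one_gt[of x] unfolding floor_eq by linarith
    have floor_le: "real (nat \<lfloor>x\<rfloor>) \<le> x"
      unfolding floor_eq by (rule of_int_floor_le)
    have mx: "real m \<le> x" using floor_le by (simp add: m_def)
    have "ennreal (real m / (64 * real ?n)) \<le>
      (SUP (P, Q) \<in> prob_vectors ?S \<times> prob_vectors ?S. sq_risk ?S ?n (g k) P Q)"
    proof (rule sup_sq_risk_ge[OF assms(6,1,2)])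
      show "0 < m" "m \<le> ?S" using x(1) assms(3) by (auto simp: m_def)
      show "m \<le> ?n" using mx x by linarith
      show "real m * ((4 * c\<^sub>1 + 4) * ln (real ?n)) \<le> real ?n"
        using mult_right_mono[OF mx, of "C * ln (real ?n)"] x Cln by (simp add: C_def)
    qed (use elim in auto)
    moreover have "h k \<le> real ?n * ln (real ?n) / real ?S * (real m / (64 * real ?n))"
    proof (cases "m = ?S")
      case True
      then show ?thesis
        using assms(3,4)[of k] by (simp add: h_def field_simps)
    next
      case False
      then have "x / 2 \<le> real m" using floor_ge by (auto simp: m_def min_def split: if_splits)
      then have "x / 2 * (ln (real ?n) / (64 * real ?S)) \<le> real m * (ln (real ?n) / (64 * real ?S))"
        using elim by (intro mult_right_mono) auto
      moreover have "x / 2 * (ln (real ?n) / (64 * real ?S)) = 1 / (128 * C) * (real ?n / real ?S)"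
        using elim C by (simp add: x_def field_simps)
      ultimately show ?thesis
        using assms(4)[of k] by (simp add: h_def field_simps)
    qed
    ultimately have "ennreal (h k) \<le> ennreal (real ?n * ln (real ?n) / real ?S) * ennreal (real m / (64 * real ?n))"
      using elim by (subst ennreal_mult[symmetric]) (auto intro!: ennreal_leI)
    also have "\<dots> \<le> ennreal (real ?n * ln (real ?n) / real ?S) *
        (SUP (P, Q) \<in> prob_vectors ?S \<times> prob_vectors ?S. sq_risk ?S ?n (g k) P Q)"
      by (intro mult_left_mono \<open>ennreal (real m / _) \<le> _\<close>) auto
    finally show ?case .
  qed
  have limit: "(\<lambda>k. ennreal (h k)) \<longlonglongrightarrow> \<infinity>"
    using h_top by (simp add: ennreal_tendsto_top_eq_at_top)
  show ?thesis
    by (rule tendsto_sandwich[OF lower _ limit tendsto_const]) simp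
qed

end
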